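(* Let $\mathbb{F}$ be a field, let $X_1,\ldots,X_n$ be finite sets, and for each $i$ fix a complement $W_i$ to the constants, $\mathbb{F}^{X_i}=\langle 1\rangle\oplus W_i$. Let $f:X_1\times\cdots\times X_n\to\mathbb{F}$ be non-zero, with associated decomposition $f=\sum_{S\subseteq[n]}f^{=S}$. If $S\subseteq[n]$ satisfies $f^{=S}\neq0$ and $|S|=\deg_\otimes(f)$, then $$\pi_{S^c}(\mathrm{supp}(f))=X_{S^c},$$ where $S^c=[n]\setminus S$. In particular, $$\dim_\pi(\mathrm{supp}(f))+\deg_\otimes(f)\ge n.$$
   Context: $[n]=\{1,\dots,n\}$ and $X=X_1\times\cdots\times X_n$. For $T\subseteq[n]$, $X_T:=\prod_{i\in T}X_i$ (with $X_\emptyset$ a one-point set) and $\pi_T:X\to X_T$, $\pi_T(x_1,\ldots,x_n)=(x_i)_{i\in T}$, is the coordinate projection; for $\mathcal{A}\subseteq X$, $\pi_T(\mathcal{A})=\{\pi_T(x):x\in\mathcal{A}\}$. For nonempty $\mathcal{A}\subseteq X$, the coordinate projection dimension is $\dim_\pi(\mathcal{A}):=\max\{|T|:T\subseteq[n],\ \pi_T(\mathcal{A})=X_T\}$. The support is $\mathrm{supp}(f)=\{x\in X:f(x)\neq0\}$. Efron--Stein decomposition: $\langle1\rangle\subseteq\mathbb{F}^{X_i}$ denotes the constant functions on $X_i$. Since $\mathbb{F}^{X}=\bigotimes_{i=1}^n\mathbb{F}^{X_i}=\bigoplus_{S\subseteq[n]}\left(\bigotimes_{i\in S}W_i\otimes\bigotimes_{i\notin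 S}\langle1\rangle\right)$, every $f:X\to\mathbb{F}$ decomposes uniquely as $f=\sum_{S\subseteq[n]}f^{=S}$ with $f^{=S}\in\bigotimes_{i\in S}W_i\otimes\bigotimes_{i\notin S}\langle1\rangle$ (here a tensor $\bigotimes_i g_i$ is the function $x\mapsto\prod_i g_i(x_i)$). For non-zero $f$, $\deg_\otimes(f):=\max\{|S|:f^{=S}\neq0\}$; equivalently, $\deg_\otimes(f)\le r$ means that $f$ lies in the linear span of all functions depending on at most $r$ coordinates. *)

theory Defs
  imports Complex_Main "HOL-Library.Function_Algebras" "HOL-Library.FuncSet"
begin

definition fun_scale :: "'f::field \<Rightarrow> ('b \<Rightarrow> 'f) \<Rightarrow> 'b \<Rightarrow> 'f"
  where "fun_scale c g = (\<lambda>x. c * g x)"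

global_interpretation fun_vs: vector_space fun_scale
  by unfold_locales (auto simp: fun_scale_def fun_eq_iff algebra_simps)

text \<open>
  The space of functions from a set \<open>A\<close> to the field is represented by the functions
  on the whole type that vanish outside \<open>A\<close>; this is a linear subspace of the full
  function space. (Extensional functions would not do, since \<open>undefined\<close> is not
  preserved by addition and scaling.)
\<close>

definition functions_on :: "'b set \<Rightarrow> ('b \<Rightarrow> 'f::field) set"
  where "functions_on A = {g. \<forall>x. x \<notin> A \<longrightarrow> g x = 0}"

definition constants_on :: "'b set \<Rightarrow> ('b \<Rightarrow> 'f::field) set"
  where "constants_on A = {g. \<exists>c. g = (\<lambda>x. if x \<in> A then c else 0)}"

definition is_direct_sum :: "('b \<Rightarrow> 'f::field) set \<Rightarrow> ('b \<Rightarrow> 'f) set \<Rightarrow> ('b \<Rightarrow> 'f) set \<Rightarrow> bool"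
  where "is_direct_sum V U W \<longleftrightarrow>
    fun_vs.subspace U \<and> fun_vs.subspace W \<and>
    V = {u + w | u w. u \<in> U \<and> w \<in> W} \<and> U \<inter> W = {0}"

text \<open>
  Points of \<open>X\<^sub>T\<close>, for \<open>T \<subseteq> [n]\<close>, are the extensional functions on \<open>T\<close> with
  \<open>i\<close>-th value in \<open>X\<^sub>i\<close>, so that the coordinate projection to \<open>T\<close> is restriction.
\<close>

definition tensor :: "nat \<Rightarrow> (nat \<Rightarrow> 'a set) \<Rightarrow> (nat \<Rightarrow> 'a \<Rightarrow> 'f::field) \<Rightarrow> (nat \<Rightarrow> 'a) \<Rightarrow> 'f"
  where "tensor n X g =
    (\<lambda>x. if x \<in> (\<Pi>\<^sub>E i\<in>{1..n}. X i) then \<Prod>i\<in>{1..n}. g i (x i) else 0)"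

definition ES_space ::
  "nat \<Rightarrow> (nat \<Rightarrow> 'a set) \<Rightarrow> (nat \<Rightarrow> ('a \<Rightarrow> 'f::field) set) \<Rightarrow> nat set \<Rightarrow> ((nat \<Rightarrow> 'a) \<Rightarrow> 'f) set"
  where "ES_space n X W S = fun_vs.span
    {tensor n X g | g. \<forall>i\<in>{1..n}. g i \<in> (if i \<in> S then W i else constants_on (X i))}"

definition is_ES_decomposition ::
  "nat \<Rightarrow> (nat \<Rightarrow> 'a set) \<Rightarrow> (nat \<Rightarrow> ('a \<Rightarrow> 'f::field) set) \<Rightarrow> ((nat \<Rightarrow> 'a) \<Rightarrow> 'f) \<Rightarrow>
    (nat set \<Rightarrow> (nat \<Rightarrow> 'a) \<Rightarrow> 'f) \<Rightarrow> bool"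
  where "is_ES_decomposition n X W f h \<longleftrightarrow>
    (\<forall>S\<subseteq>{1..n}. h S \<in> ES_space n X W S) \<and> f = (\<Sum>S\<in>Pow {1..n}. h S)"

text \<open>
  The component \<open>f\<^sup>=\<^sup>S\<close>. The decomposition determines \<open>h\<close> only on subsets of \<open>[n]\<close>,
  so the description operator is applied to the value \<open>h S\<close> and not to \<open>h\<close>.
\<close>

definition ES_component ::
  "nat \<Rightarrow> (nat \<Rightarrow> 'a set) \<Rightarrow> (nat \<Rightarrow> ('a \<Rightarrow> 'f::field) set) \<Rightarrow> ((nat \<Rightarrow> 'a) \<Rightarrow> 'f) \<Rightarrow>
    nat set \<Rightarrow> (nat \<Rightarrow> 'a) \<Rightarrow> 'f"
  where "ES_component n X W f S = (THE g. \<exists>h. is_ES_decomposition n X W f h \<and> g = h S)"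

definition deg_tensor ::
  "nat \<Rightarrow> (nat \<Rightarrow> 'a set) \<Rightarrow> (nat \<Rightarrow> ('a \<Rightarrow> 'f::field) set) \<Rightarrow> ((nat \<Rightarrow> 'a) \<Rightarrow> 'f) \<Rightarrow> nat"
  where "deg_tensor n X W f = Max {card S | S. S \<subseteq> {1..n} \<and> ES_component n X W f S \<noteq> 0}"

definition proj :: "nat set \<Rightarrow> (nat \<Rightarrow> 'a) \<Rightarrow> nat \<Rightarrow> 'a"
  where "proj T x = restrict x T"

definition dim_proj :: "nat \<Rightarrow> (nat \<Rightarrow> 'a set) \<Rightarrow> (nat \<Rightarrow> 'a) set \<Rightarrow> nat"
  where "dim_proj n X A = Max {card T | T. T \<subseteq> {1..n} \<and> proj T ` A = (\<Pi>\<^sub>E i\<in>T. X i)}"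

definition supp :: "nat \<Rightarrow> (nat \<Rightarrow> 'a set) \<Rightarrow> ((nat \<Rightarrow> 'a) \<Rightarrow> 'f::field) \<Rightarrow> (nat \<Rightarrow> 'a) set"
  where "supp n X f = {x \<in> (\<Pi>\<^sub>E i\<in>{1..n}. X i). f x \<noteq> 0}"

end

theory Submission
  imports Defs
begin

text \<open>
  As \<open>f \<noteq> 0\<close>, every \<open>X\<^sub>i\<close> is non-empty. Then a complement \<open>W\<^sub>i\<close> of the constants is the
  kernel of a unique linear functional taking the value \<open>1\<close> on the constant function \<open>1\<close>,
  and as \<open>X\<^sub>i\<close> is finite this functional is a weighted
  sum \<open>g \<mapsto> \<Sum>b. \<mu>\<^sub>i b * g b\<close> (lemma \<open>complement_weights\<close>). So \<open>W\<^sub>i\<close> consists of the functions of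
  mean zero for a total weight of \<open>1\<close>, and averaging over the \<open>i\<close>-th coordinate,
  \<open>E\<^sub>i\<close>, is the projection to the constants along \<open>W\<^sub>i\<close>. Hence
  \<open>f\<^sup>=\<^sup>S\<close> is obtained from \<open>f\<close> by applying \<open>1 - E\<^sub>i\<close> for \<open>i \<in> S\<close> and \<open>E\<^sub>i\<close> for \<open>i \<notin> S\<close>
  (lemma \<open>ES_component_eq\<close>).

  Now let \<open>Q\<^sub>S\<close> apply \<open>1 - E\<^sub>i\<close> for \<open>i \<in> S\<close> only. It fixes \<open>f\<^sup>=\<^sup>T\<close> when \<open>S \<subseteq> T\<close> and kills it
  otherwise. If \<open>f\<^sup>=\<^sup>S \<noteq> 0\<close> and \<open>S\<close> has maximal size, no proper superset \<open>T\<close> of \<open>S\<close> contributes, so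
  \<open>Q\<^sub>S f = f\<^sup>=\<^sup>S\<close> (lemma \<open>partial_projection_top\<close>). The two sides see the coordinates outside
  \<open>S\<close> in opposite ways. On the left, the values of \<open>Q\<^sub>S f\<close> over a point \<open>z \<in> X\<^bsub>S\<^sup>c\<^esub>\<close> are
  computed from the values of \<open>f\<close> over the same \<open>z\<close>. On the right, \<open>f\<^sup>=\<^sup>S\<close> does not depend on
  these coordinates at all, so being non-zero it is non-zero somewhere over every \<open>z\<close>.
  Hence \<open>f\<close> is non-zero somewhere over every \<open>z\<close>.

  All operators involved are tensor products of one-coordinate operators; they are written as
  matrices whose entries are products of one-coordinate entries, which avoids any reasoning
  about the order in which the \<open>E\<^sub>i\<close> are applied.
\<close>

section \<open>Complements of the constants as spaces of mean-zero functions\<close>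

definition point_mass :: "'b \<Rightarrow> 'b \<Rightarrow> 'f::field"
  where "point_mass b = (\<lambda>a. if a = b then 1 else 0)"

definition const_on :: "'b set \<Rightarrow> 'f::field \<Rightarrow> 'b \<Rightarrow> 'f"
  where "const_on A c = (\<lambda>a. if a \<in> A then c else 0)"

lemma const_on_in_constants_on: "const_on A c \<in> constants_on A"
  by (auto simp: const_on_def constants_on_def)

lemma sum_fun_apply: "(\<Sum>i\<in>I. F i) x = (\<Sum>i\<in>I. F i x)"
  by (induction I rule: infinite_finite_induct) auto

text \<open>
  The weight of \<open>b\<close> is the constant part of the point mass at \<open>b\<close>. The function \<open>g\<close> is the
  combination of point masses with coefficients \<open>g b\<close>, so it differs from its weighted sum by
  an element of \<open>W\<close>; for \<open>g \<in> W\<close> and for \<open>g = 1\<close> the last two properties follow from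
  \<open>W \<inter> \<langle>1\<rangle> = 0\<close>.
\<close>

lemma complement_weights:
  fixes W :: "('b \<Rightarrow> 'f::field) set"
  assumes fin: "finite A" and ne: "A \<noteq> {}"
    and dir: "is_direct_sum (functions_on A) (constants_on A) W"
  obtains m :: "'b \<Rightarrow> 'f" where
    "\<And>b. b \<in> A \<Longrightarrow> point_mass b - const_on A (m b) \<in> W"
    "\<And>g. g \<in> W \<Longrightarrow> (\<Sum>b\<in>A. m b * g b) = 0"
    "(\<Sum>b\<in>A. m b) = 1"
proof -
  have subW: "fun_vs.subspace W" and int: "constants_on A \<inter> W = {0}"
    and V: "functions_on A = {u + w | u w. u \<in> constants_on A \<and> w \<in> W}"
    using dir by (auto simp: is_direct_sum_def)
  have "\<exists>c. point_mass b - const_on A c \<in> W" if "b \<in> A" for b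
  proof -
    have "(point_mass b :: 'b \<Rightarrow> 'f) \<in> functions_on A"
      using that by (auto simp: functions_on_def point_mass_def)
    then obtain u w where "u \<in> constants_on A" "w \<in> W" "point_mass b = u + w"
      unfolding V by blast
    moreover then obtain c where "u = const_on A c"
      by (auto simp: constants_on_def const_on_def)
    ultimately show ?thesis by (intro exI[of _ c]) simp
  qed
  then obtain m where m: "\<And>b. b \<in> A \<Longrightarrow> point_mass b - const_on A (m b) \<in> W"
    by metis
  have W_on: "W \<subseteq> functions_on A"
  proof
    fix w assume "w \<in> W"
    moreover have "(0 :: 'b \<Rightarrow> 'f) \<in> constants_on A" using int by auto
    ultimately show "w \<in> functions_on A" unfolding V by force
  qed
  have zero: "c = 0" if "const_on A c \<in> W" for c
  proof -
    have "const_on A c = 0" using that const_on_in_constants_on[of A c] int by blast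
    then show ?thesis using ne by (auto simp: const_on_def fun_eq_iff split: if_splits)
  qed
  have key: "g - const_on A (\<Sum>b\<in>A. m b * g b) \<in> W" if g: "g \<in> functions_on A" for g
  proof -
    have "(\<Sum>b\<in>A. fun_scale (g b) (point_mass b - const_on A (m b))) \<in> W"
      by (intro fun_vs.subspace_sum fun_vs.subspace_scale subW m)
    also have "(\<Sum>b\<in>A. fun_scale (g b) (point_mass b - const_on A (m b)))
        = g - const_on A (\<Sum>b\<in>A. m b * g b)"
    proof
      fix x
      have "(\<Sum>b\<in>A. g b * (point_mass b x - const_on A (m b) x))
          = (\<Sum>b\<in>A. if x = b then g b else 0) - (\<Sum>b\<in>A. const_on A (m b * g b) x)"
        unfolding sum_subtractf[symmetric]
        by (intro sum.cong) (auto simp: point_mass_def const_on_def algebra_simps)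
      also have "(\<Sum>b\<in>A. if x = b then g b else 0) = g x"
        using fin g by (auto simp: functions_on_def)
      also have "(\<Sum>b\<in>A. const_on A (m b * g b) x) = const_on A (\<Sum>b\<in>A. m b * g b) x"
        by (simp add: const_on_def)
      finally show "(\<Sum>b\<in>A. fun_scale (g b) (point_mass b - const_on A (m b))) x
          = (g - const_on A (\<Sum>b\<in>A. m b * g b)) x"
        by (simp add: sum_fun_apply fun_scale_def)
    qed
    finally show ?thesis .
  qed
  show thesis
  proof
    show "point_mass b - const_on A (m b) \<in> W" if "b \<in> A" for b using m that .
    show "(\<Sum>b\<in>A. m b * g b) = 0" if g: "g \<in> W" for g
    proof (rule zero)
      have "g - (g - const_on A (\<Sum>b\<in>A. m b * g b)) \<in> W"
        by (rule fun_vs.subspace_diff[OF subW g key]) (use g W_on in blast)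
      then show "const_on A (\<Sum>b\<in>A. m b * g b) \<in> W" by simp
    qed
    have "const_on A 1 \<in> functions_on A" by (auto simp: const_on_def functions_on_def)
    from key[OF this] have "const_on A 1 - const_on A (\<Sum>b\<in>A. m b) \<in> W"
      by (simp add: const_on_def cong: sum.cong)
    also have "const_on A 1 - const_on A (\<Sum>b\<in>A. m b) = const_on A (1 - (\<Sum>b\<in>A. m b))"
      by (auto simp: const_on_def)
    finally show "(\<Sum>b\<in>A. m b) = 1" using zero by fastforce
  qed
qed

section \<open>Tensor products of matrices acting on functions on a product\<close>

definition kernel_op ::
  "nat \<Rightarrow> (nat \<Rightarrow> 'a set) \<Rightarrow> (nat \<Rightarrow> 'a \<Rightarrow> 'a \<Rightarrow> 'f::field) \<Rightarrow>
    ((nat \<Rightarrow> 'a) \<Rightarrow> 'f) \<Rightarrow> (nat \<Rightarrow> 'a) \<Rightarrow> 'f"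
  where "kernel_op n X k f =
    (\<lambda>x. if x \<in> (\<Pi>\<^sub>E i\<in>{1..n}. X i)
      then \<Sum>y\<in>(\<Pi>\<^sub>E i\<in>{1..n}. X i). (\<Prod>i\<in>{1..n}. k i (x i) (y i)) * f y else 0)"

lemma kernel_op_zero: "kernel_op n X k 0 = 0"
  by (auto simp: kernel_op_def)

lemma kernel_op_add: "kernel_op n X k (f + g) = kernel_op n X k f + kernel_op n X k g"
  by (auto simp: kernel_op_def fun_eq_iff sum.distrib algebra_simps)

lemma kernel_op_scale: "kernel_op n X k (fun_scale c f) = fun_scale c (kernel_op n X k f)"
  by (auto simp: kernel_op_def fun_scale_def fun_eq_iff sum_distrib_left algebra_simps)

lemma kernel_op_sum: "kernel_op n X k (\<Sum>i\<in>I. F i) = (\<Sum>i\<in>I. kernel_op n X k (F i))"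
proof
  fix x
  show "kernel_op n X k (\<Sum>i\<in>I. F i) x = (\<Sum>i\<in>I. kernel_op n X k (F i)) x"
  proof (cases "x \<in> (\<Pi>\<^sub>E i\<in>{1..n}. X i)")
    case True
    then show ?thesis
      by (simp add: kernel_op_def sum_fun_apply sum_distrib_left) (rule sum.swap)
  qed (simp add: kernel_op_def sum_fun_apply)
qed

lemma kernel_op_tensor:
  assumes fin: "\<And>i. i \<in> {1..n} \<Longrightarrow> finite (X i)"
  shows "kernel_op n X k (tensor n X g) = tensor n X (\<lambda>i a. \<Sum>b\<in>X i. k i a b * g i b)"
proof
  fix x
  have "(\<Sum>y\<in>(\<Pi>\<^sub>E i\<in>{1..n}. X i). (\<Prod>i\<in>{1..n}. k i (x i) (y i)) * tensor n X g y)
      = (\<Sum>y\<in>(\<Pi>\<^sub>E i\<in>{1..n}. X i). \<Prod>i\<in>{1..n}. k i (x i) (y i) * g i (y i))"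
    by (intro sum.cong) (auto simp: tensor_def prod.distrib)
  also have "\<dots> = (\<Prod>i\<in>{1..n}. \<Sum>b\<in>X i. k i (x i) b * g i b)"
    by (rule prod_sum_PiE[symmetric]) (use fin in auto)
  finally show "kernel_op n X k (tensor n X g) x
      = tensor n X (\<lambda>i a. \<Sum>b\<in>X i. k i a b * g i b) x"
    by (simp add: kernel_op_def tensor_def)
qed

text \<open>
  A tensor product of operators acts on a space spanned by tensors of eigenvectors as the
  product of the eigenvalues.
\<close>

lemma kernel_op_eigen:
  fixes X :: "nat \<Rightarrow> 'a set" and W :: "nat \<Rightarrow> ('a \<Rightarrow> 'f::field) set"
  assumes fin: "\<And>i. i \<in> {1..n} \<Longrightarrow> finite (X i)"
    and eig: "\<And>i g a. i \<in> {1..n} \<Longrightarrow> g \<in> (if i \<in> T then W i else constants_on (X i)) \<Longrightarrow>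
      a \<in> X i \<Longrightarrow> (\<Sum>b\<in>X i. k i a b * g b) = c i * g a"
    and h: "h \<in> ES_space n X W T"
  shows "kernel_op n X k h = fun_scale (\<Prod>i\<in>{1..n}. c i) h"
  using h[unfolded ES_space_def]
proof (induction rule: fun_vs.span_induct_alt)
  case base
  show "kernel_op n X k 0 = fun_scale (\<Prod>i\<in>{1..n}. c i) 0"
    unfolding kernel_op_zero fun_vs.scale_zero_right ..
next
  case (step d t h)
  then obtain g where t: "t = tensor n X g"
    and g: "\<And>i. i \<in> {1..n} \<Longrightarrow> g i \<in> (if i \<in> T then W i else constants_on (X i))"
    by blast
  have "kernel_op n X k t = fun_scale (\<Prod>i\<in>{1..n}. c i) t"
  proof
    fix x
    have "(\<Prod>i\<in>{1..n}. \<Sum>b\<in>X i. k i (x i) b * g i b) = (\<Prod>i\<in>{1..n}. c i * g i (x i))"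
      if "x \<in> (\<Pi>\<^sub>E i\<in>{1..n}. X i)"
      by (intro prod.cong refl eig g) (use that in auto)
    moreover have "kernel_op n X k t = tensor n X (\<lambda>i a. \<Sum>b\<in>X i. k i a b * g i b)"
      unfolding t by (rule kernel_op_tensor) (rule fin)
    ultimately show "kernel_op n X k t x = fun_scale (\<Prod>i\<in>{1..n}. c i) t x"
      by (simp add: t tensor_def fun_scale_def prod.distrib)
  qed
  with step show "kernel_op n X k (fun_scale d t + h)
      = fun_scale (\<Prod>i\<in>{1..n}. c i) (fun_scale d t + h)"
    by (simp only: kernel_op_add kernel_op_scale fun_vs.scale_right_distrib
        fun_vs.scale_left_commute)
qed

lemma ES_space_outside:
  assumes "h \<in> ES_space n X W S" and "x \<notin> (\<Pi>\<^sub>E i\<in>{1..n}. X i)"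
  shows "h x = 0"
  using assms(1)[unfolded ES_space_def]
proof (induction rule: fun_vs.span_induct_alt)
  case (step c t h)
  then obtain g where "t = tensor n X g" by blast
  then have "t x = 0" using assms(2) by (simp only: tensor_def if_False)
  with step show ?case by (simp add: fun_scale_def)
qed simp

lemma ES_space_depends_on:
  fixes X :: "nat \<Rightarrow> 'a set" and W :: "nat \<Rightarrow> ('a \<Rightarrow> 'f::field) set"
  assumes "h \<in> ES_space n X W S"
    and x: "x \<in> (\<Pi>\<^sub>E i\<in>{1..n}. X i)" and y: "y \<in> (\<Pi>\<^sub>E i\<in>{1..n}. X i)"
    and eq: "\<And>i. i \<in> S \<Longrightarrow> x i = y i"
  shows "h x = h y"
  using assms(1)[unfolded ES_space_def]
proof (induction rule: fun_vs.span_induct_alt)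
  case (step c t h)
  then obtain g where t: "t = tensor n X g"
    and g: "\<And>i. i \<in> {1..n} \<Longrightarrow> g i \<in> (if i \<in> S then W i else constants_on (X i))"
    by blast
  have "g i (x i) = g i (y i)" if i: "i \<in> {1..n}" for i
  proof (cases "i \<in> S")
    case False
    moreover have "x i \<in> X i" "y i \<in> X i" using x y i by auto
    ultimately show ?thesis using g[OF i] by (auto simp: constants_on_def)
  qed (simp add: eq)
  then have "t x = t y" unfolding t tensor_def using x y by (auto intro: prod.cong)
  with step show ?case by (simp add: fun_scale_def)
qed simp

section \<open>The components as images of projections\<close>

locale weighted_complements =
  fixes n :: nat and X :: "nat \<Rightarrow> 'a set" and W :: "nat \<Rightarrow> ('a \<Rightarrow> 'f::field) set"
    and \<mu> :: "nat \<Rightarrow> 'a \<Rightarrow> 'f"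
  assumes fin: "\<And>i. i \<in> {1..n} \<Longrightarrow> finite (X i)"
    and centred_in_W: "\<And>i b. i \<in> {1..n} \<Longrightarrow> b \<in> X i \<Longrightarrow>
      point_mass b - const_on (X i) (\<mu> i b) \<in> W i"
    and W_mean_zero: "\<And>i g. i \<in> {1..n} \<Longrightarrow> g \<in> W i \<Longrightarrow> (\<Sum>b\<in>X i. \<mu> i b * g b) = 0"
    and total_weight: "\<And>i. i \<in> {1..n} \<Longrightarrow> (\<Sum>b\<in>X i. \<mu> i b) = 1"
begin

abbreviation points :: "(nat \<Rightarrow> 'a) set"
  where "points \<equiv> (\<Pi>\<^sub>E i\<in>{1..n}. X i)"

lemma finite_points: "finite points"
  using fin by (auto intro: finite_PiE)

text \<open>The matrix of \<open>1 - E\<^sub>i\<close>; that of \<open>E\<^sub>i\<close> has the entries \<open>\<mu> i b\<close>.\<close>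

definition centring :: "nat \<Rightarrow> 'a \<Rightarrow> 'a \<Rightarrow> 'f"
  where "centring i a b = point_mass b a - \<mu> i b"

definition component :: "nat set \<Rightarrow> ((nat \<Rightarrow> 'a) \<Rightarrow> 'f) \<Rightarrow> (nat \<Rightarrow> 'a) \<Rightarrow> 'f"
  where "component S = kernel_op n X (\<lambda>i a b. if i \<in> S then centring i a b else \<mu> i b)"

definition partial_projection :: "nat set \<Rightarrow> ((nat \<Rightarrow> 'a) \<Rightarrow> 'f) \<Rightarrow> (nat \<Rightarrow> 'a) \<Rightarrow> 'f"
  where "partial_projection S =
    kernel_op n X (\<lambda>i a b. if i \<in> S then centring i a b else point_mass b a)"

lemma identity_apply:
  assumes "i \<in> {1..n}" "a \<in> X i"
  shows "(\<Sum>b\<in>X i. point_mass b a * g b) = g a"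
proof -
  have "(\<Sum>b\<in>X i. point_mass b a * g b) = (\<Sum>b\<in>X i. if a = b then g b else 0)"
    by (intro sum.cong) (auto simp: point_mass_def)
  then show ?thesis using assms fin by simp
qed

lemma mean_constant:
  assumes "i \<in> {1..n}" "g \<in> constants_on (X i)" "a \<in> X i"
  shows "(\<Sum>b\<in>X i. \<mu> i b * g b) = g a"
proof -
  obtain c where c: "g = (\<lambda>x. if x \<in> X i then c else 0)"
    using assms by (auto simp: constants_on_def)
  have "(\<Sum>b\<in>X i. \<mu> i b * g b) = (\<Sum>b\<in>X i. \<mu> i b) * c"
    unfolding sum_distrib_right by (intro sum.cong) (auto simp: c)
  then show ?thesis using assms by (simp add: c total_weight)
qed

lemma centring_apply:
  assumes "i \<in> {1..n}" "a \<in> X i"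
  shows "(\<Sum>b\<in>X i. centring i a b * g b) = g a - (\<Sum>b\<in>X i. \<mu> i b * g b)"
  using identity_apply[OF assms] by (simp add: centring_def left_diff_distrib sum_subtractf)

text \<open>
  The factors of \<open>component S\<close> are complementary projections: \<open>E\<^sub>i\<close> is \<open>0\<close> on \<open>W i\<close> and the
  identity on constants. A coordinate on which \<open>S\<close> and \<open>T\<close> disagree gives the eigenvalue \<open>0\<close>.
\<close>

lemma component_ES_space:
  assumes h: "h \<in> ES_space n X W T" and "S \<subseteq> {1..n}" "T \<subseteq> {1..n}"
  shows "component S h = (if S = T then h else 0)"
proof -
  have "component S h =
      fun_scale (\<Prod>i\<in>{1..n}. if (i \<in> S) = (i \<in> T) then 1 else 0) h"
    unfolding component_def
    by (rule kernel_op_eigen[OF fin _ h])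
      (auto simp: W_mean_zero mean_constant centring_apply split: if_splits)
  moreover have "\<exists>i\<in>{1..n}. (i \<in> S) \<noteq> (i \<in> T)" if "S \<noteq> T"
    using that assms by blast
  ultimately show ?thesis by (auto simp: fun_scale_def fun_eq_iff)
qed

text \<open>
  With the identity instead of \<open>E\<^sub>i\<close> outside \<open>S\<close>, only a coordinate in \<open>S - T\<close> gives the
  eigenvalue \<open>0\<close>.
\<close>

lemma partial_projection_ES_space:
  assumes h: "h \<in> ES_space n X W T" and "S \<subseteq> {1..n}"
  shows "partial_projection S h = (if S \<subseteq> T then h else 0)"
proof -
  have "partial_projection S h =
      fun_scale (\<Prod>i\<in>{1..n}. if i \<in> S \<longrightarrow> i \<in> T then 1 else 0) h"
    unfolding partial_projection_def
  proof (rule kernel_op_eigen[OF fin _ h])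
    fix i g a
    assume "i \<in> {1..n}" "g \<in> (if i \<in> T then W i else constants_on (X i))" "a \<in> X i"
    then show "(\<Sum>b\<in>X i. (if i \<in> S then centring i a b else point_mass b a) * g b)
        = (if i \<in> S \<longrightarrow> i \<in> T then 1 else 0) * g a"
      by (cases "i \<in> S"; cases "i \<in> T")
        (simp_all add: W_mean_zero mean_constant centring_apply identity_apply)
  qed
  moreover have "(\<Prod>i\<in>{1..n}. if i \<in> S \<longrightarrow> i \<in> T then 1 else 0 :: 'f) = (if S \<subseteq> T then 1 else 0)"
  proof (cases "S \<subseteq> T")
    case False
    then have "\<exists>i\<in>{1..n}. i \<in> S \<and> i \<notin> T" using assms by blast
    with False show ?thesis by auto
  qed (auto intro!: prod.neutral)
  ultimately show ?thesis by (auto simp: fun_scale_def fun_eq_iff)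
qed

text \<open>
  Column \<open>y\<close> of the matrix of \<open>component S\<close> is the tensor of the columns \<open>y i\<close> of its factors,
  which lie in \<open>W i\<close> or are constant.
\<close>

lemma component_in_ES_space: "component S f \<in> ES_space n X W S"
proof -
  define col where "col y i = (if i \<in> S then point_mass (y i) - const_on (X i) (\<mu> i (y i))
    else const_on (X i) (\<mu> i (y i)))" for y i
  have "component S f = (\<Sum>y\<in>points. fun_scale (f y) (tensor n X (col y)))"
  proof
    fix x
    show "component S f x = (\<Sum>y\<in>points. fun_scale (f y) (tensor n X (col y))) x"
    proof (cases "x \<in> points")
      case True
      have "(\<Prod>i\<in>{1..n}. if i \<in> S then centring i (x i) (y i) else \<mu> i (y i))
          = (\<Prod>i\<in>{1..n}. col y i (x i))" for y
        by (rule prod.cong) (use True in \<open>auto simp: col_def centring_def const_on_def\<close>)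
      then show ?thesis using True
        by (simp add: component_def kernel_op_def sum_fun_apply fun_scale_def tensor_def
            mult.commute)
    qed (simp add: component_def kernel_op_def sum_fun_apply fun_scale_def tensor_def)
  qed
  also have "\<dots> \<in> ES_space n X W S"
    unfolding ES_space_def
  proof (intro fun_vs.span_sum fun_vs.span_scale fun_vs.span_base)
    fix y assume "y \<in> points"
    then have "\<forall>i\<in>{1..n}. col y i \<in> (if i \<in> S then W i else constants_on (X i))"
      by (auto simp: col_def const_on_in_constants_on intro!: centred_in_W)
    then show "tensor n X (col y) \<in> {tensor n X g | g.
        \<forall>i\<in>{1..n}. g i \<in> (if i \<in> S then W i else constants_on (X i))}"
      by blast
  qed
  finally show ?thesis .
qed

text \<open>Expanding \<open>\<Prod>i. ((1 - E\<^sub>i) + E\<^sub>i) = 1\<close> over all \<open>S\<close> gives the decomposition.\<close>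

lemma sum_components:
  assumes f: "f \<in> functions_on points"
  shows "f = (\<Sum>S\<in>Pow {1..n}. component S f)"
proof
  fix x
  show "f x = (\<Sum>S\<in>Pow {1..n}. component S f) x"
  proof (cases "x \<in> points")
    case True
    have entry: "(\<Sum>S\<in>Pow {1..n}. \<Prod>i\<in>{1..n}. if i \<in> S then centring i (x i) (y i) else \<mu> i (y i))
        = (if y = x then 1 else 0)" if y: "y \<in> points" for y
    proof -
      have "(\<Sum>S\<in>Pow {1..n}. \<Prod>i\<in>{1..n}. if i \<in> S then centring i (x i) (y i) else \<mu> i (y i))
          = (\<Sum>S\<in>Pow {1..n}. (\<Prod>i\<in>S. centring i (x i) (y i)) * (\<Prod>i\<in>{1..n}-S. \<mu> i (y i)))"
        by (intro sum.cong refl) (auto simp: prod.If_cases Int_absorb1 Diff_eq)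
      also have "\<dots> = (\<Prod>i\<in>{1..n}. centring i (x i) (y i) + \<mu> i (y i))"
        by (rule prod_add[symmetric]) simp
      also have "\<dots> = (\<Prod>i\<in>{1..n}. if x i = y i then 1 else 0)"
        by (simp add: centring_def point_mass_def)
      also have "\<dots> = (if y = x then 1 else 0)"
        using True y by (auto intro!: PiE_ext[OF y True] prod.neutral)
      finally show ?thesis .
    qed
    have "(\<Sum>S\<in>Pow {1..n}. component S f) x = (\<Sum>S\<in>Pow {1..n}. \<Sum>y\<in>points.
        (\<Prod>i\<in>{1..n}. if i \<in> S then centring i (x i) (y i) else \<mu> i (y i)) * f y)"
      using True by (simp add: sum_fun_apply component_def kernel_op_def)
    also have "\<dots> = (\<Sum>y\<in>points. (if y = x then 1 else 0) * f y)"
      unfolding sum.swap[of _ _ "Pow {1..n}"] sum_distrib_right[symmetric]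
      by (intro sum.cong refl) (simp only: entry)
    also have "\<dots> = (\<Sum>y\<in>points. if y = x then f y else 0)"
      by (intro sum.cong) auto
    also have "\<dots> = f x"
      using finite_points True by simp
    finally show ?thesis by simp
  next
    case False
    then show ?thesis using f
      by (simp add: sum_fun_apply component_def kernel_op_def functions_on_def)
  qed
qed

text \<open>
  Applying \<open>component S\<close> to any decomposition \<open>f = (\<Sum>T. h T)\<close> leaves only \<open>h S\<close>; this is the
  uniqueness that makes the description operator in \<open>ES_component\<close> well-defined.
\<close>

lemma ES_component_eq:
  assumes f: "f \<in> functions_on points" and S: "S \<subseteq> {1..n}"
  shows "ES_component n X W f S = component S f"
  unfolding ES_component_def
proof (rule the_equality)
  show "\<exists>h. is_ES_decomposition n X W f h \<and> component S f = h S"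
    using component_in_ES_space sum_components[OF f]
    by (intro exI[of _ "\<lambda>S. component S f"]) (auto simp: is_ES_decomposition_def)
next
  fix g assume "\<exists>h. is_ES_decomposition n X W f h \<and> g = h S"
  then obtain h where h: "\<And>T. T \<subseteq> {1..n} \<Longrightarrow> h T \<in> ES_space n X W T"
    and fh: "f = (\<Sum>T\<in>Pow {1..n}. h T)" and g: "g = h S"
    by (auto simp: is_ES_decomposition_def)
  have "component S f = (\<Sum>T\<in>Pow {1..n}. component S (h T))"
    unfolding fh component_def by (rule kernel_op_sum)
  also have "\<dots> = (\<Sum>T\<in>Pow {1..n}. if S = T then h T else 0)"
    by (intro sum.cong) (auto simp: component_ES_space[OF h S])
  also have "\<dots> = h S" using S by simp
  finally show "g = component S f" using g by simp
qed

section \<open>The support over a component of maximal degree\<close>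

lemma partial_projection_top:
  assumes f: "f \<in> functions_on points" and S: "S \<subseteq> {1..n}"
    and top: "\<And>T. T \<subseteq> {1..n} \<Longrightarrow> S \<subset> T \<Longrightarrow> component T f = 0"
  shows "partial_projection S f = component S f"
proof -
  have "partial_projection S f = partial_projection S (\<Sum>T\<in>Pow {1..n}. component T f)"
    using sum_components[OF f] by simp
  also have "\<dots> = (\<Sum>T\<in>Pow {1..n}. partial_projection S (component T f))"
    unfolding partial_projection_def by (rule kernel_op_sum)
  also have "\<dots> = (\<Sum>T\<in>Pow {1..n}. if S = T then component T f else 0)"
    using top
    by (intro sum.cong refl) (auto simp: partial_projection_ES_space[OF component_in_ES_space S])
  also have "\<dots> = component S f" using S by simp
  finally show ?thesis .
qed

text \<open>
  The matrix of \<open>partial_projection S\<close> has identity factors outside \<open>S\<close>, so its entry at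
  \<open>(x, y)\<close> vanishes unless \<open>x\<close> and \<open>y\<close> agree there.
\<close>

lemma partial_projection_fibre:
  assumes x: "partial_projection S f x \<noteq> 0"
  shows "\<exists>y\<in>points. f y \<noteq> 0 \<and> (\<forall>i\<in>{1..n} - S. y i = x i)"
proof -
  from x obtain y where y: "y \<in> points"
    and ne: "(\<Prod>i\<in>{1..n}. if i \<in> S then centring i (x i) (y i) else point_mass (y i) (x i)) * f y \<noteq> 0"
    unfolding partial_projection_def kernel_op_def
    by (auto elim!: sum.not_neutral_contains_not_neutral split: if_splits)
  have "y i = x i" if "i \<in> {1..n} - S" for i
  proof -
    have "\<forall>i\<in>{1..n}. (if i \<in> S then centring i (x i) (y i) else point_mass (y i) (x i)) \<noteq> 0"
      using ne by auto
    from bspec[OF this, of i] show ?thesis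
      using that by (auto simp: point_mass_def split: if_splits)
  qed
  moreover have "f y \<noteq> 0" using ne by (rule contrapos_nn) simp
  ultimately show ?thesis using y by blast
qed

text \<open>
  Starting from a point \<open>x0\<close> where \<open>component S f\<close> is non-zero, the coordinates outside \<open>S\<close>
  may be replaced by those of the prescribed \<open>z\<close> without changing its value.
\<close>

lemma proj_supp_surjective:
  assumes f: "f \<in> functions_on points" and S: "S \<subseteq> {1..n}"
    and nz: "component S f \<noteq> 0"
    and top: "\<And>T. T \<subseteq> {1..n} \<Longrightarrow> S \<subset> T \<Longrightarrow> component T f = 0"
  shows "proj ({1..n} - S) ` supp n X f = (\<Pi>\<^sub>E i\<in>{1..n} - S. X i)"
proof
  show "proj ({1..n} - S) ` supp n X f \<subseteq> (\<Pi>\<^sub>E i\<in>{1..n} - S. X i)"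
    by (auto simp: proj_def supp_def intro!: restrict_PiE_iff[THEN iffD2])
next
  show "(\<Pi>\<^sub>E i\<in>{1..n} - S. X i) \<subseteq> proj ({1..n} - S) ` supp n X f"
  proof
    fix z assume z: "z \<in> (\<Pi>\<^sub>E i\<in>{1..n} - S. X i)"
    obtain x0 where x0: "component S f x0 \<noteq> 0" using nz by (auto simp: fun_eq_iff)
    then have x0P: "x0 \<in> points" using ES_space_outside[OF component_in_ES_space] by blast
    define x where "x i = (if i \<in> S then x0 i else z i)" for i
    have "x \<in> points"
      using x0P z S by (auto simp: x_def PiE_iff extensional_def)
    then have "component S f x = component S f x0"
      using x0P by (intro ES_space_depends_on[OF component_in_ES_space]) (auto simp: x_def)
    moreover have "partial_projection S f = component S f"
      by (rule partial_projection_top[OF f S]) (rule top)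
    ultimately have "partial_projection S f x \<noteq> 0" using x0 by simp
    from partial_projection_fibre[OF this]
    obtain y where y: "y \<in> points" "f y \<noteq> 0" "\<forall>i\<in>{1..n} - S. y i = x i" by blast
    have "z = proj ({1..n} - S) y"
      using z y(3) by (simp add: proj_def x_def fun_eq_iff PiE_iff extensional_def restrict_def)
    with y show "z \<in> proj ({1..n} - S) ` supp n X f" by (auto simp: supp_def)
  qed
qed

end

theorem theorem3p2:
  fixes n :: nat
    and X :: "nat \<Rightarrow> 'a set"
    and W :: "nat \<Rightarrow> ('a \<Rightarrow> 'f::field) set"
    and f :: "(nat \<Rightarrow> 'a) \<Rightarrow> 'f"
  assumes "\<And>i. i \<in> {1..n} \<Longrightarrow> finite (X i)"
    and "\<And>i. i \<in> {1..n} \<Longrightarrow> is_direct_sum (functions_on (X i)) (constants_on (X i)) (W i)"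
    and "f \<in> functions_on (\<Pi>\<^sub>E i\<in>{1..n}. X i)"
    and "f \<noteq> 0"
  shows "(\<forall>S. S \<subseteq> {1..n} \<and> ES_component n X W f S \<noteq> 0 \<and> card S = deg_tensor n X W f \<longrightarrow>
            proj ({1..n} - S) ` supp n X f = (\<Pi>\<^sub>E i\<in>{1..n} - S. X i))
       \<and> dim_proj n X (supp n X f) + deg_tensor n X W f \<ge> n"
proof -
  obtain p where "f p \<noteq> 0" using assms(4) by (auto simp: fun_eq_iff)
  then have "p \<in> (\<Pi>\<^sub>E i\<in>{1..n}. X i)" using assms(3) by (auto simp: functions_on_def)
  then have ne: "X i \<noteq> {}" if "i \<in> {1..n}" for i using that by auto
  have "\<exists>m. (\<forall>b\<in>X i. point_mass b - const_on (X i) (m b) \<in> W i) \<and>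
      (\<forall>g\<in>W i. (\<Sum>b\<in>X i. m b * g b) = 0) \<and> (\<Sum>b\<in>X i. m b) = 1" if "i \<in> {1..n}" for i
    using complement_weights[OF assms(1)[OF that] ne[OF that] assms(2)[OF that]] by metis
  then obtain \<mu> where \<mu>: "\<And>i. i \<in> {1..n} \<Longrightarrow>
      (\<forall>b\<in>X i. point_mass b - const_on (X i) (\<mu> i b) \<in> W i) \<and>
      (\<forall>g\<in>W i. (\<Sum>b\<in>X i. \<mu> i b * g b) = 0) \<and> (\<Sum>b\<in>X i. \<mu> i b) = 1"
    by metis
  interpret weighted_complements n X W \<mu>
    by unfold_locales (use assms(1) \<mu> in auto)
  let ?C = "ES_component n X W f"
  let ?D = "{card S | S. S \<subseteq> {1..n} \<and> ?C S \<noteq> 0}"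
  have finD: "finite ?D"
    by (rule finite_subset[of _ "card ` Pow {1..n}"]) auto
  have surj: "proj ({1..n} - S) ` supp n X f = (\<Pi>\<^sub>E i\<in>{1..n} - S. X i)"
    if S: "S \<subseteq> {1..n}" and nz: "?C S \<noteq> 0" and deg: "card S = deg_tensor n X W f" for S
  proof (rule proj_supp_surjective[OF assms(3) S])
    show "component S f \<noteq> 0" using nz ES_component_eq[OF assms(3) S] by simp
    fix T assume T: "T \<subseteq> {1..n}" "S \<subset> T"
    show "component T f = 0"
    proof (rule ccontr)
      assume "component T f \<noteq> 0"
      then have "card T \<in> ?D" using T ES_component_eq[OF assms(3) T(1)] by auto
      then have "card T \<le> card S" unfolding deg deg_tensor_def using finD by (rule Max_ge[rotated])
      moreover have "card S < card T" using T by (meson finite_atLeastAtMost finite_subset psubset_card_mono)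
      ultimately show False by simp
    qed
  qed
  have "?D \<noteq> {}"
  proof
    assume "?D = {}"
    then have "component S f = 0" if "S \<subseteq> {1..n}" for S
      using that ES_component_eq[OF assms(3) that] by auto
    then have "f = 0" using sum_components[OF assms(3)] by (simp add: sum.neutral)
    with assms(4) show False ..
  qed
  from Max_in[OF finD this] obtain S where S: "S \<subseteq> {1..n}" "?C S \<noteq> 0"
    and deg: "card S = deg_tensor n X W f"
    unfolding deg_tensor_def by auto
  have "card ({1..n} - S) \<le> dim_proj n X (supp n X f)"
    unfolding dim_proj_def
  proof (rule Max_ge)
    show "finite {card T | T. T \<subseteq> {1..n} \<and> proj T ` supp n X f = (\<Pi>\<^sub>E i\<in>T. X i)}"
      by (rule finite_subset[of _ "card ` Pow {1..n}"]) auto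
  qed (use surj[OF S deg] in blast)
  moreover have "card ({1..n} - S) = n - card S"
    using S by (simp add: card_Diff_subset finite_subset)
  ultimately have "n \<le> dim_proj n X (supp n X f) + deg_tensor n X W f" using deg by simp
  with surj show ?thesis by blast
qed

end
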